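(* Let $x\in\mathbb{C}\setminus\delta\mathbb{Z}^{-}$, let $\delta,\rho,a,b\in\mathbb{R}^{+}\setminus\{0\}$, and let $\operatorname{Re}(x-\rho n)>0$ for $n\in\mathbb{N}$. Then the fundamental equation satisfied by the Four Parameter Gamma Function is $$x\,\Gamma(\delta,a;\rho,b)(x)=\frac{\delta}{a}\,\Gamma(\delta,a;\rho,b)(x+\delta)-\frac{\rho}{b}\,\Gamma(\delta,a;\rho,b)(x-\rho).$$
   Context: The Four Parameter Gamma Function (ultra gamma function) is defined by $$\Gamma(\delta,a;\rho,b)(x)=\int_{0}^{\infty}t^{x-1}e^{-\frac{t^{\delta}}{a}-\frac{t^{-\rho}}{b}}\,dt,$$ where $x\in\mathbb{C}\setminus\delta\mathbb{Z}^{-}$, $\delta,\rho,a,b\in\mathbb{R}^{+}\setminus\{0\}$ and $\operatorname{Re}(x-\rho n)>0$ for $n\in\mathbb{N}$. Here $\mathbb{C}$, $\mathbb{R}^{+}$, $\mathbb{Z}^{-}$ and $\mathbb{N}$ are the sets of complex numbers, positive real numbers, negative integers and natural numbers, $\operatorname{Re}$ is the real part, and $\delta\mathbb{Z}^{-}=\{\delta m: m\in\mathbb{Z}^{-}\}$. *)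

theory Defs
  imports "HOL-Analysis.Analysis"
begin

text \<open>
  The restrictions on \<open>x\<close> that accompany the integral in the literature
  (\<open>x \<notin> \<delta>\<int>\<^sup>-\<close> and \<open>Re (x - \<rho>n) > 0\<close>) are left to the theorems: for
  \<open>\<delta>, a, \<rho>, b > 0\<close> the factors \<open>exp (- (t powr \<delta>) / a)\<close> and
  \<open>exp (- (t powr - \<rho>) / b)\<close> make the integrand absolutely integrable for
  every complex \<open>x\<close>, so the Lebesgue integral never takes its default value 0
  for want of convergence.
\<close>

definition ultra_gamma :: "real \<Rightarrow> real \<Rightarrow> real \<Rightarrow> real \<Rightarrow> complex \<Rightarrow> complex" where
  "ultra_gamma \<delta> a \<rho> b x =
     (LINT t:{0<..}|lborel.
        complex_of_real t powr (x - 1) *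
        complex_of_real (exp (- (t powr \<delta>) / a - (t powr (- \<rho>)) / b)))"

definition scaled_neg_ints :: "real \<Rightarrow> complex set" where
  "scaled_neg_ints \<delta> = {complex_of_real \<delta> * of_int m | m. m < 0}"

end

theory Submission
  imports Defs "HOL-Real_Asymp.Real_Asymp"
begin

text \<open>
  The boundary terms of \<open>t powr x * exp (- t powr \<delta> / a - t powr - \<rho> / b)\<close> vanish at both \<open>0\<close> and
  \<open>\<infinity>\<close>, so its derivative has integral \<open>0\<close> over the positive half-line. That derivative is the
  combination of the three integrands in the functional equation.
\<close>

text \<open>The limits control \<open>f\<close> near \<open>0\<close> and near infinity up to an
  error of \<open>1\<close>, and compactness controls it in between. This turns asymptotic
  information at the two ends into one global constant.\<close>

lemma continuous_on_greaterThan_bounded: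
  fixes f :: "real \<Rightarrow> real"
  assumes cont: "continuous_on {0<..} f"
    and lim0: "(f \<longlongrightarrow> l) (at_right 0)" and lim_top: "(f \<longlongrightarrow> m) at_top"
  obtains C where "\<And>t. t > 0 \<Longrightarrow> \<bar>f t\<bar> \<le> C"
proof -
  have "eventually (\<lambda>t. dist (f t) l < 1) (at_right 0)"
    using lim0 by (rule tendstoD) simp
  then obtain p where p: "p > 0" "\<And>t. 0 < t \<Longrightarrow> t < p \<Longrightarrow> dist (f t) l < 1"
    by (auto simp: eventually_at_right_field)
  have "eventually (\<lambda>t. dist (f t) m < 1) at_top"
    using lim_top by (rule tendstoD) simp
  then obtain q where q: "\<And>t. t \<ge> q \<Longrightarrow> dist (f t) m < 1"
    by (auto simp: eventually_at_top_linorder)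
  \<comment> \<open>The order of \<open>p\<close> and \<open>q\<close> is unknown; if
    \<open>q < p\<close> the interval is empty and the middle range below is vacuous.\<close>
  have "compact (f ` {p..q})"
    using p(1) by (intro compact_continuous_image continuous_on_subset[OF cont]) auto
  then have "bounded (f ` {p..q})"
    by (rule compact_imp_bounded)
  then obtain B where "\<forall>y\<in>f ` {p..q}. norm y \<le> B"
    unfolding bounded_iff by (elim exE)
  then have B: "\<And>t. p \<le> t \<Longrightarrow> t \<le> q \<Longrightarrow> \<bar>f t\<bar> \<le> B"
    by simp
  show thesis
  proof
    fix t :: real
    assume "t > 0"
    then consider "t < p" | "p \<le> t" "t \<le> q" | "q \<le> t" by linarith
    then show "\<bar>f t\<bar> \<le> max B (max (\<bar>l\<bar> + 1) (\<bar>m\<bar> + 1))"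
    proof cases
      case 1
      then show ?thesis using p(2)[OF \<open>t > 0\<close>] by (auto simp: dist_real_def)
    next
      case 2
      then show ?thesis using B by fastforce
    next
      case 3
      then show ?thesis using q[of t] by (auto simp: dist_real_def)
    qed
  qed
qed

text \<open>The antiderivative \<open>arctan\<close> has finite limits at both ends. The function
  serves as the dominating function for every integrand below.\<close>

lemma set_integrable_inverse_1_plus_square:
  "set_integrable lborel {0<..} (\<lambda>t::real. inverse (1 + t\<^sup>2))"
proof -
  have nz: "1 + t\<^sup>2 \<noteq> 0" for t :: real
    using zero_le_power2[of t] by linarith
  have "set_integrable lborel (einterval (ereal 0) \<infinity>) (\<lambda>t::real. inverse (1 + t\<^sup>2))"
  proof (rule interval_integral_FTC_nonneg(1)[where F = arctan and A = 0 and B = "pi / 2"])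
    have "(arctan \<longlongrightarrow> arctan 0) (at_right 0)"
      by (intro tendsto_intros)
    then show "((arctan \<circ> real_of_ereal) \<longlongrightarrow> 0) (at_right (ereal 0))"
      by (simp add: ereal_tendsto_simps1)
    show "((arctan \<circ> real_of_ereal) \<longlongrightarrow> pi / 2) (at_left \<infinity>)"
      by (simp add: ereal_tendsto_simps1 tendsto_arctan_at_top)
  qed (auto intro!: DERIV_arctan continuous_intros simp: nz)
  then show ?thesis by simp
qed

context
  fixes \<delta> a \<rho> b :: real
  assumes pos: "\<delta> > 0" "a > 0" "\<rho> > 0" "b > 0"
begin

text \<open>Here \<open>exp (- (t powr \<delta>) / a)\<close> outweighs any power of
  \<open>t\<close>, while the other exponential factor tends to \<open>1\<close>.\<close>

lemma powr_mult_ultra_gamma_weight_at_top: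
  "((\<lambda>t. t powr s * exp (- (t powr \<delta>) / a - (t powr (- \<rho>)) / b)) \<longlongrightarrow> 0) at_top"
  using pos by real_asymp

text \<open>Here the roles swap: \<open>exp (- (t powr (- \<rho>)) / b)\<close> decays faster than
  any negative power of \<open>t\<close> can grow.\<close>

lemma powr_mult_ultra_gamma_weight_at_right_0:
  "((\<lambda>t. t powr s * exp (- (t powr \<delta>) / a - (t powr (- \<rho>)) / b)) \<longlongrightarrow> 0) (at_right 0)"
  using pos by real_asymp

text \<open>Even after multiplication by \<open>1 + t\<^sup>2\<close> the norm of the integrand
  stays bounded, so a constant multiple of \<open>inverse (1 + t\<^sup>2)\<close> dominates
  it.\<close>

lemma set_integrable_ultra_gamma:
  fixes z :: complex
  shows "set_integrable lborel {0<..} (\<lambda>t. complex_of_real t powr z *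
    complex_of_real (exp (- (t powr \<delta>) / a - (t powr (- \<rho>)) / b)))"
    (is "set_integrable _ _ ?f")
proof -
  define w where "w t = exp (- (t powr \<delta>) / a - (t powr (- \<rho>)) / b)" for t
  \<comment> \<open>This is the norm of the integrand times \<open>1 + t\<^sup>2\<close>, expanded
    so that the limit lemmas apply with \<open>s = Re z\<close> and
    \<open>s = Re z + 2\<close>.\<close>
  define h where "h t = t powr Re z * w t + t powr (Re z + 2) * w t" for t
  have "continuous_on {0<..} h"
    unfolding h_def w_def using pos by (auto intro!: continuous_intros)
  moreover have "(h \<longlongrightarrow> 0) (at_right 0)"
    unfolding h_def w_def
    using tendsto_add[OF powr_mult_ultra_gamma_weight_at_right_0 powr_mult_ultra_gamma_weight_at_right_0]
    by simp
  moreover have "(h \<longlongrightarrow> 0) at_top"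
    unfolding h_def w_def
    using tendsto_add[OF powr_mult_ultra_gamma_weight_at_top powr_mult_ultra_gamma_weight_at_top]
    by simp
  ultimately obtain C where C: "\<And>t. t > 0 \<Longrightarrow> \<bar>h t\<bar> \<le> C"
    by (rule continuous_on_greaterThan_bounded) (rule that)
  have bound: "norm (?f t) \<le> norm (C * inverse (1 + t\<^sup>2))" if "t > 0" for t
  proof -
    have h: "h t = t powr Re z * w t * (1 + t\<^sup>2)"
      using that by (simp add: h_def powr_add algebra_simps)
    have "norm (?f t) = t powr Re z * w t"
      using that by (simp add: norm_mult norm_powr_real_powr w_def)
    also have "\<dots> = h t * inverse (1 + t\<^sup>2)"
      using that by (simp add: h add_pos_pos less_imp_neq[symmetric])
    also have "\<dots> \<le> C * inverse (1 + t\<^sup>2)"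
      using C[OF that] by (intro mult_right_mono) auto
    finally show ?thesis by simp
  qed
  show ?thesis
  proof (rule set_integrable_bound)
    show "set_integrable lborel {0<..} (\<lambda>t. C * inverse (1 + t\<^sup>2))"
      using set_integrable_inverse_1_plus_square by (rule set_integrable_mult_right)
    \<comment> \<open>Positive reals avoid the branch cut of the complex power.\<close>
    have "continuous_on {0<..} ?f"
      using pos by (auto intro!: continuous_intros simp: complex_nonpos_Reals_iff)
    then show "set_borel_measurable lborel {0<..} ?f"
      unfolding set_borel_measurable_def measurable_lborel1
      using borel_measurable_continuous_on_indicator[of "{0<..}" ?f] by simp
  qed (use bound in auto)
qed

text \<open>By the product rule, differentiating the exponent brings down one power of
  \<open>t\<close> for each of its two terms. Absorbed into \<open>t powr x\<close>, these powers
  become the shifts by \<open>\<delta>\<close> and \<open>- \<rho>\<close>, so each summand is an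
  integrand of \<open>ultra_gamma\<close>.\<close>

lemma has_vector_derivative_powr_ultra_gamma_weight:
  fixes x :: complex
  defines "w \<equiv> \<lambda>t. complex_of_real (exp (- (t powr \<delta>) / a - (t powr (- \<rho>)) / b))"
  assumes "t > 0"
  shows "((\<lambda>t. complex_of_real t powr x * w t) has_vector_derivative
    x * (complex_of_real t powr (x - 1) * w t)
    - complex_of_real (\<delta> / a) * (complex_of_real t powr (x + complex_of_real \<delta> - 1) * w t)
    + complex_of_real (\<rho> / b) * (complex_of_real t powr (x - complex_of_real \<rho> - 1) * w t)) (at t)"
proof -
  have powr: "((\<lambda>t. complex_of_real t powr x) has_vector_derivative
      x * complex_of_real t powr (x - 1)) (at t)"
    using assms
    by (intro has_vector_derivative_real_field)
       (auto intro!: derivative_eq_intros simp: complex_nonpos_Reals_iff)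
  have "((\<lambda>t. exp (- (t powr \<delta>) / a - (t powr (- \<rho>)) / b)) has_real_derivative
      exp (- (t powr \<delta>) / a - (t powr (- \<rho>)) / b) *
      (\<rho> / b * t powr (- \<rho> - 1) - \<delta> / a * t powr (\<delta> - 1))) (at t)"
    using assms pos by (auto intro!: derivative_eq_intros simp: field_simps)
  then have "(w has_vector_derivative
      w t * complex_of_real (\<rho> / b * t powr (- \<rho> - 1) - \<delta> / a * t powr (\<delta> - 1))) (at t)"
    unfolding w_def of_real_mult[symmetric] by (rule has_vector_derivative_of_real)
  from has_vector_derivative_mult[OF powr this]
  have "((\<lambda>t. complex_of_real t powr x * w t) has_vector_derivative
      complex_of_real t powr x *
        (w t * complex_of_real (\<rho> / b * t powr (- \<rho> - 1) - \<delta> / a * t powr (\<delta> - 1)))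
      + x * complex_of_real t powr (x - 1) * w t) (at t)" .
  \<comment> \<open>A single exponent law with real shift \<open>c\<close> covers both terms,
    through \<open>c = \<delta>\<close> and \<open>c = - \<rho>\<close>.\<close>
  moreover have "complex_of_real t powr (x + complex_of_real c - 1) =
      complex_of_real t powr x * complex_of_real (t powr (c - 1))" for c
    using assms by (simp add: powr_of_real[symmetric] powr_add[symmetric] algebra_simps)
  from this[of \<delta>] this[of "- \<rho>"]
  have "complex_of_real t powr (x + complex_of_real \<delta> - 1) =
      complex_of_real t powr x * complex_of_real (t powr (\<delta> - 1))"
    and "complex_of_real t powr (x - complex_of_real \<rho> - 1) =
      complex_of_real t powr x * complex_of_real (t powr (- \<rho> - 1))"
    by simp_all
  ultimately show ?thesis
    by (simp add: algebra_simps)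
qed

lemma ultra_gamma_functional_equation:
  "x * ultra_gamma \<delta> a \<rho> b x =
     complex_of_real (\<delta> / a) * ultra_gamma \<delta> a \<rho> b (x + complex_of_real \<delta>)
   - complex_of_real (\<rho> / b) * ultra_gamma \<delta> a \<rho> b (x - complex_of_real \<rho>)"
proof -
  define w where "w t = complex_of_real (exp (- (t powr \<delta>) / a - (t powr (- \<rho>)) / b))" for t
  define g where "g z t = complex_of_real t powr (z - 1) * w t" for z t
  define F where "F t = complex_of_real t powr x * w t" for t
  define f where "f t = x * g x t - complex_of_real (\<delta> / a) * g (x + complex_of_real \<delta>) t
    + complex_of_real (\<rho> / b) * g (x - complex_of_real \<rho>) t" for t
  have int_g: "set_integrable lborel {0<..} (g z)" for z
    unfolding g_def w_def by (rule set_integrable_ultra_gamma)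
  have int_cg: "set_integrable lborel {0<..} (\<lambda>t. c * g z t)" for c z
    using int_g by (rule set_integrable_mult_right)
  have ultra_gamma: "ultra_gamma \<delta> a \<rho> b z = (LINT t:{0<..}|lborel. g z t)" for z
    by (simp add: ultra_gamma_def g_def w_def)
  \<comment> \<open>Since the norm of \<open>t powr x\<close> is \<open>t powr Re x\<close> for
    positive \<open>t\<close>, both boundary limits reduce to the real ones with
    \<open>s = Re x\<close>.\<close>
  have norm_F: "norm (F t) = t powr Re x * exp (- (t powr \<delta>) / a - (t powr (- \<rho>)) / b)"
    if "t > 0" for t
    using that by (simp add: F_def w_def norm_mult norm_powr_real_powr)
  have "((\<lambda>t. norm (F t)) \<longlongrightarrow> 0) (at_right 0)"
    by (rule Lim_transform_eventually[OF powr_mult_ultra_gamma_weight_at_right_0[of "Re x"]])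
       (auto simp: norm_F intro: eventually_mono[OF eventually_at_right_less])
  then have F_0: "(F \<longlongrightarrow> 0) (at_right 0)"
    by (rule tendsto_norm_zero_cancel)
  have "((\<lambda>t. norm (F t)) \<longlongrightarrow> 0) at_top"
    by (rule Lim_transform_eventually[OF powr_mult_ultra_gamma_weight_at_top[of "Re x"]])
       (auto simp: norm_F intro: eventually_mono[OF eventually_gt_at_top[of 0]])
  then have F_top: "(F \<longlongrightarrow> 0) at_top"
    by (rule tendsto_norm_zero_cancel)
  \<comment> \<open>The fundamental theorem on the open half-line: \<open>f\<close> is the
    derivative of \<open>F\<close>, and the two zeros are the limits of \<open>F\<close> at infinity
    and at \<open>0\<close>.\<close>
  have "(LBINT t=ereal 0..\<infinity>. f t) = 0 - 0"
  proof (rule interval_integral_FTC_integrable[where F = F])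
    show "(F has_vector_derivative f t) (at t)" if "ereal 0 < ereal t" for t
      unfolding F_def f_def g_def w_def
      using that by (intro has_vector_derivative_powr_ultra_gamma_weight) simp
    show "isCont f t" if "ereal 0 < ereal t" for t
      using that pos unfolding f_def g_def w_def
      by (auto intro!: continuous_intros simp: complex_nonpos_Reals_iff)
    show "set_integrable lborel (einterval (ereal 0) \<infinity>) f"
      unfolding f_def by (simp add: int_cg del: set_integrable_mult_right)
  qed (use F_0 F_top in \<open>simp_all add: ereal_tendsto_simps1\<close>)
  then have "(LINT t:{0<..}|lborel. f t) = 0"
    by (simp only: interval_integral_to_infinity_eq diff_self)
  \<comment> \<open>Linearity of the integral is legitimate because each of the three summands is
    integrable on its own, by \<open>int_cg\<close>.\<close>
  moreover have "(LINT t:{0<..}|lborel. f t) = x * ultra_gamma \<delta> a \<rho> b x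
      - complex_of_real (\<delta> / a) * ultra_gamma \<delta> a \<rho> b (x + complex_of_real \<delta>)
      + complex_of_real (\<rho> / b) * ultra_gamma \<delta> a \<rho> b (x - complex_of_real \<rho>)"
    unfolding f_def ultra_gamma
    by (simp only: set_integral_add set_integral_diff int_cg set_integral_mult_right)
  ultimately show ?thesis
    by (simp add: algebra_simps)
qed

end

theorem theorem2p4:
  fixes \<delta> a \<rho> b :: real and x :: complex and n :: nat
  assumes "\<delta> > 0" and "a > 0" and "\<rho> > 0" and "b > 0"
    and "x \<notin> scaled_neg_ints \<delta>"
    and "Re (x - complex_of_real \<rho> * of_nat n) > 0"
  shows "x * ultra_gamma \<delta> a \<rho> b x =
           complex_of_real (\<delta> / a) * ultra_gamma \<delta> a \<rho> b (x + complex_of_real \<delta>)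
         - complex_of_real (\<rho> / b) * ultra_gamma \<delta> a \<rho> b (x - complex_of_real \<rho>)"
  using assms(1-4) by (rule ultra_gamma_functional_equation)

end
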